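(* If $L:\mathrm{Lip}(I\times J)\to\mathrm{Lip}(I\times J)$ is a continuous (not necessarily linear) operator, then the $\alpha$-fractal operator $\mathcal{F}^{\alpha}_{\Delta,L}:\mathrm{Lip}(I\times J)\to\mathcal{C}(I\times J)$ is also continuous.
   Context: Let $a<b$, $c<d$, $I=[a,b]$, $J=[c,d]$, $\mathbb{N}=\{1,2,\dots\}$, $\mathbb{N}_0=\mathbb{N}\cup\{0\}$. $\mathcal{C}(I\times J)$ is the Banach space of continuous real-valued functions on $I\times J$ with sup-norm $\|\cdot\|_\infty$; $\mathrm{Lip}(I\times J)\subset\mathcal{C}(I\times J)$ is the subspace of Lipschitz functions (Euclidean norm on $\mathbb{R}^2$), equipped with the sup-norm. Continuity is with respect to the sup-norm. Partition: $\Delta=\{x_i:i\in\mathbb{N}_0\}\times\{y_j:j\in\mathbb{N}_0\}$ with $(x_i)$, $(y_j)$ strictly increasing, $x_0=a$, $y_0=c$, $x_i\to b=:x_\infty$, $y_j\to d=:y_\infty$. Put $I_i=[x_{i-1},x_i]$, $J_j=[y_{j-1},y_j]$ for $i,j\in\mathbb{N}$. Affine maps: $u_i:I\to I_i$ is the affine bijection with $u_i(a)=x_{i-1}$, $u_i(b)=x_i$ if $i$ is odd, and $u_i(a)=x_i$, $u_i(b)=x_{i-1}$ if $i$ is even; $v_j:J\to J_j$ is defined likewise with the $y_j$. Scale function: $\alpha=(\alpha_{ij})_{i,j\in\mathbb{N}}$ is a double sequence of Lipschitz functions on $I\times J$ with uniformly bounded Lipschitz constants and $\|\alpha\|_\infty:=\sup_{i,j}\|\alpha_{ij}\|_\infty<1$.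 Parameter map: $L:\mathrm{Lip}(I\times J)\to\mathrm{Lip}(I\times J)$ is an operator with $L(f)(x_k,y_l)=f(x_k,y_l)$ for all $f$ and all $k,l\in\{0,\infty\}$. $\alpha$-fractal function: for $f\in\mathrm{Lip}(I\times J)$, $f^{\alpha}_{\Delta,L}$ is the unique function in $\mathcal{C}(I\times J)$ with $f^{\alpha}_{\Delta,L}(x_k,y_l)=f(x_k,y_l)$ for $k,l\in\{0,\infty\}$ and $$f^{\alpha}_{\Delta,L}(x,y)=f(x,y)+\alpha_{ij}(x,y)\big[f^{\alpha}_{\Delta,L}(u_i^{-1}(x),v_j^{-1}(y))-L(f)(u_i^{-1}(x),v_j^{-1}(y))\big]$$ for all $(x,y)\in I_i\times J_j$, $i,j\in\mathbb{N}$ (values on $x=b$ or $y=d$ being determined by continuity). Standing assumption: the parameters $\alpha,\Delta,L$ are permissible, i.e. this function exists for every $f\in\mathrm{Lip}(I\times J)$. The $\alpha$-fractal operator is $\mathcal{F}^{\alpha}_{\Delta,L}(f)=f^{\alpha}_{\Delta,L}$. *)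

theory Defs
  imports "HOL-Analysis.Analysis"
begin

(* Elements of these function spaces are extensional (undefined outside S); for the scale functions
   below only the values on the rectangle matter. The product metric on
   real * real is the Euclidean one. *)

definition cont_metric :: "(real \<times> real) set \<Rightarrow> (real \<times> real \<Rightarrow> real) metric"
  where "cont_metric S = cfunspace (top_of_set S) euclidean_metric"

definition lip_metric :: "(real \<times> real) set \<Rightarrow> (real \<times> real \<Rightarrow> real) metric"
  where "lip_metric S = submetric (cont_metric S) {f. \<exists>C. C-lipschitz_on S f}"

definition partition_seq :: "real \<Rightarrow> real \<Rightarrow> (nat \<Rightarrow> real) \<Rightarrow> bool"
  where "partition_seq a b x \<longleftrightarrow> strict_mono x \<and> x 0 = a \<and> x \<longlonglongrightarrow> b"

definition affine_interp :: "real \<Rightarrow> real \<Rightarrow> real \<Rightarrow> real \<Rightarrow> real \<Rightarrow> real"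
  where "affine_interp a b p q t = p + (t - a) / (b - a) * (q - p)"

definition part_map :: "real \<Rightarrow> real \<Rightarrow> (nat \<Rightarrow> real) \<Rightarrow> nat \<Rightarrow> real \<Rightarrow> real"
  where "part_map a b x i =
    (if odd i then affine_interp a b (x (i - 1)) (x i) else affine_interp a b (x i) (x (i - 1)))"

definition part_inv :: "real \<Rightarrow> real \<Rightarrow> (nat \<Rightarrow> real) \<Rightarrow> nat \<Rightarrow> real \<Rightarrow> real"
  where "part_inv a b x i = inv_into {a..b} (part_map a b x i)"

(* Valued in ereal, because the supremum of an unbounded set of reals is unspecified.
   Indices of scale functions and of subintervals start at 1. *)
definition scale_norm :: "(real \<times> real) set \<Rightarrow> (nat \<Rightarrow> nat \<Rightarrow> real \<times> real \<Rightarrow> real) \<Rightarrow> ereal"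
  where "scale_norm S \<alpha> = (SUP i\<in>{1..}. SUP j\<in>{1..}. SUP z\<in>S. ereal \<bar>\<alpha> i j z\<bar>)"

definition scale_function :: "(real \<times> real) set \<Rightarrow> (nat \<Rightarrow> nat \<Rightarrow> real \<times> real \<Rightarrow> real) \<Rightarrow> bool"
  where "scale_function S \<alpha> \<longleftrightarrow>
    (\<exists>K. \<forall>i\<ge>1. \<forall>j\<ge>1. K-lipschitz_on S (\<alpha> i j)) \<and> scale_norm S \<alpha> < 1"

definition agree_at_corners ::
  "real \<Rightarrow> real \<Rightarrow> real \<Rightarrow> real \<Rightarrow> (real \<times> real \<Rightarrow> real) \<Rightarrow> (real \<times> real \<Rightarrow> real) \<Rightarrow> bool"
  where "agree_at_corners a b c d g f \<longleftrightarrow> (\<forall>s\<in>{a, b}. \<forall>t\<in>{c, d}. g (s, t) = f (s, t))"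

definition parameter_map ::
  "real \<Rightarrow> real \<Rightarrow> real \<Rightarrow> real \<Rightarrow> ((real \<times> real \<Rightarrow> real) \<Rightarrow> real \<times> real \<Rightarrow> real) \<Rightarrow> bool"
  where "parameter_map a b c d L \<longleftrightarrow>
    (\<forall>f \<in> mspace (lip_metric ({a..b} \<times> {c..d})).
       L f \<in> mspace (lip_metric ({a..b} \<times> {c..d})) \<and> agree_at_corners a b c d (L f) f)"

definition is_alpha_fractal ::
  "real \<Rightarrow> real \<Rightarrow> real \<Rightarrow> real \<Rightarrow> (nat \<Rightarrow> real) \<Rightarrow> (nat \<Rightarrow> real) \<Rightarrow>
   (nat \<Rightarrow> nat \<Rightarrow> real \<times> real \<Rightarrow> real) \<Rightarrow> ((real \<times> real \<Rightarrow> real) \<Rightarrow> real \<times> real \<Rightarrow> real) \<Rightarrow>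
   (real \<times> real \<Rightarrow> real) \<Rightarrow> (real \<times> real \<Rightarrow> real) \<Rightarrow> bool"
  where "is_alpha_fractal a b c d x y \<alpha> L f g \<longleftrightarrow>
    g \<in> mspace (cont_metric ({a..b} \<times> {c..d})) \<and>
    agree_at_corners a b c d g f \<and>
    (\<forall>i\<ge>1. \<forall>j\<ge>1. \<forall>s \<in> {x (i - 1)..x i}. \<forall>t \<in> {y (j - 1)..y j}.
       g (s, t) = f (s, t) + \<alpha> i j (s, t) *
         (g (part_inv a b x i s, part_inv c d y j t) -
          L f (part_inv a b x i s, part_inv c d y j t)))"

(* Only existence is required: uniqueness of the fractal function follows from scale_norm < 1. *)
definition permissible ::
  "real \<Rightarrow> real \<Rightarrow> real \<Rightarrow> real \<Rightarrow> (nat \<Rightarrow> real) \<Rightarrow> (nat \<Rightarrow> real) \<Rightarrow>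
   (nat \<Rightarrow> nat \<Rightarrow> real \<times> real \<Rightarrow> real) \<Rightarrow> ((real \<times> real \<Rightarrow> real) \<Rightarrow> real \<times> real \<Rightarrow> real) \<Rightarrow> bool"
  where "permissible a b c d x y \<alpha> L \<longleftrightarrow>
    (\<forall>f \<in> mspace (lip_metric ({a..b} \<times> {c..d})). \<exists>g. is_alpha_fractal a b c d x y \<alpha> L f g)"

definition fractal_operator ::
  "real \<Rightarrow> real \<Rightarrow> real \<Rightarrow> real \<Rightarrow> (nat \<Rightarrow> real) \<Rightarrow> (nat \<Rightarrow> real) \<Rightarrow>
   (nat \<Rightarrow> nat \<Rightarrow> real \<times> real \<Rightarrow> real) \<Rightarrow> ((real \<times> real \<Rightarrow> real) \<Rightarrow> real \<times> real \<Rightarrow> real) \<Rightarrow>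
   (real \<times> real \<Rightarrow> real) \<Rightarrow> (real \<times> real \<Rightarrow> real)"
  where "fractal_operator a b c d x y \<alpha> L f = (THE g. is_alpha_fractal a b c d x y \<alpha> L f g)"

end

(* Subtracting the functional equations of two fractal functions g1, g2 of f1, f2 bounds
   |g1 - g2| by d(f1, f2) + q (d(g1, g2) + d(L f1, L f2)) with q = |\<alpha>| < 1, first on the union
   [a, b) x [c, d) of the cells and then, by density, everywhere. Solving for d(g1, g2) gives
   (1 - q) d(g1, g2) <= d(f1, f2) + q d(L f1, L f2), hence both uniqueness and continuity. *)

theory Submission
  imports Defs
begin

text \<open>The least \<open>n\<close> with \<open>s < x n\<close> serves as index; it exists since
  \<open>x\<close> tends to \<open>b\<close>, and is at least 1 since
  \<open>x 0 = a \<le> s\<close>. The interval is half-open because \<open>b\<close> is only the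
  limit of the nodes and lies in no cell.\<close>

lemma ex_partition_cell:
  assumes "partition_seq a b x" "s \<in> {a..<b}"
  obtains i where "i \<ge> 1" "s \<in> {x (i - 1)..x i}"
proof -
  have x0: "x 0 = a" and lim: "x \<longlonglongrightarrow> b"
    using assms(1) by (auto simp: partition_seq_def)
  have "\<forall>\<^sub>F n in sequentially. s < x n"
    using lim assms(2) by (intro order_tendstoD) auto
  then have ex: "\<exists>n. s < x n"
    by (auto simp: eventually_sequentially)
  define i where "i = (LEAST n. s < x n)"
  have i: "s < x i"
    unfolding i_def using ex by (rule LeastI_ex)
  have "i \<ge> 1"
    using i x0 assms(2) by (cases i) auto
  moreover have "\<not> s < x (i - 1)"
    using not_less_Least[of "i - 1" "\<lambda>n. s < x n"] \<open>i \<ge> 1\<close> by (auto simp: i_def)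
  ultimately show thesis
    using i that[of i] by simp
qed

text \<open>With \<open>r\<close> the relative position of \<open>s\<close> in
  \<open>{p..q}\<close>, the preimages are \<open>a + r * (b - a)\<close> and
  \<open>b - r * (b - a)\<close>. The two orientations are those of \<open>part_map\<close> at odd
  and even indices.\<close>

lemma affine_interp_surj:
  assumes "a < b" "p < q" "s \<in> {p..q}"
  shows "s \<in> affine_interp a b p q ` {a..b}" "s \<in> affine_interp a b q p ` {a..b}"
proof -
  define r where "r = (s - p) / (q - p)"
  have r: "0 \<le> r" "r \<le> 1" and s: "s = p + r * (q - p)"
    using assms by (auto simp: r_def divide_simps)
  have "0 \<le> r * (b - a)" "r * (b - a) \<le> b - a"
    using r assms(1) by (auto intro: mult_left_le_one_le)
  then have m: "a + r * (b - a) \<in> {a..b}" "b - r * (b - a) \<in> {a..b}"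
    by auto
  have "affine_interp a b p q (a + r * (b - a)) = s"
    using assms(1) s by (simp add: affine_interp_def)
  moreover have "affine_interp a b q p (b - r * (b - a)) = s"
  proof -
    have "(b - r * (b - a) - a) / (b - a) = 1 - r"
      using assms(1) by (simp add: field_simps)
    then show ?thesis
      unfolding affine_interp_def by (simp only: s) (simp add: algebra_simps)
  qed
  ultimately show "s \<in> affine_interp a b p q ` {a..b}" "s \<in> affine_interp a b q p ` {a..b}"
    using m by (metis image_eqI)+
qed

text \<open>\<open>inv_into\<close> is sure to land in \<open>{a..b}\<close> only for points of the
  image, hence the appeal to surjectivity. This keeps the rescaled arguments of the functional
  equation inside the rectangle.\<close>

lemma part_inv_in:
  assumes "a < b" "strict_mono x" "i \<ge> 1" "s \<in> {x (i - 1)..x i}"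
  shows "part_inv a b x i s \<in> {a..b}"
proof -
  have "x (i - 1) < x i"
    using assms(2,3) by (simp add: strict_mono_less)
  then have "s \<in> part_map a b x i ` {a..b}"
    using affine_interp_surj[OF assms(1) _ assms(4)] by (simp add: part_map_def)
  then show ?thesis
    unfolding part_inv_def by (rule inv_into_into)
qed

lemma scale_function_bound:
  assumes "scale_function S \<alpha>" "S \<noteq> {}"
  obtains q where "0 \<le> q" "q < 1" "\<And>i j z. i \<ge> 1 \<Longrightarrow> j \<ge> 1 \<Longrightarrow> z \<in> S \<Longrightarrow> \<bar>\<alpha> i j z\<bar> \<le> q"
proof -
  have le: "ereal \<bar>\<alpha> i j z\<bar> \<le> scale_norm S \<alpha>" if "i \<ge> 1" "j \<ge> 1" "z \<in> S" for i j z
    unfolding scale_norm_def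
    using that by (intro SUP_upper2[of i] SUP_upper2[of j] SUP_upper2[of z]) auto
  \<comment> \<open>Over an empty \<open>S\<close> the supremum would be
    \<open>-\<infinity>\<close>. A point of \<open>S\<close> makes it nonnegative; being also below
    1, it is a real number \<open>q\<close>.\<close>
  obtain z where z: "z \<in> S" using assms(2) by blast
  have "0 \<le> ereal \<bar>\<alpha> 1 1 z\<bar>" by simp
  also have "\<dots> \<le> scale_norm S \<alpha>" using le z by simp
  finally have nonneg: "0 \<le> scale_norm S \<alpha>" .
  have less: "scale_norm S \<alpha> < 1"
    using assms(1) by (simp add: scale_function_def)
  obtain q where q: "scale_norm S \<alpha> = ereal q"
    using nonneg less by (cases "scale_norm S \<alpha>") auto
  show thesis
    using that[of q] nonneg less le by (auto simp: q)
qed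

lemma mspace_lip_metric_subset: "mspace (lip_metric S) \<subseteq> mspace (cont_metric S)"
  by (auto simp: lip_metric_def)

lemma mdist_lip_metric: "mdist (lip_metric S) = mdist (cont_metric S)"
  by (simp add: lip_metric_def)

lemma abs_diff_le_mdist_cont_metric:
  assumes "f \<in> mspace (cont_metric S)" "g \<in> mspace (cont_metric S)" "z \<in> S"
  shows "\<bar>f z - g z\<bar> \<le> mdist (cont_metric S) f g"
  using mdist_cfunspace_imp_mdist_le[of f "top_of_set S" euclidean_metric g, OF _ _ order_refl, of z]
    assms by (simp add: cont_metric_def dist_real_def)

lemma continuous_on_mspace_cont_metric:
  "f \<in> mspace (cont_metric S) \<Longrightarrow> continuous_on S f"
  by (simp add: cont_metric_def)

lemma mdist_cont_metric_le:
  assumes "0 \<le> B" "\<And>z. z \<in> S \<Longrightarrow> \<bar>f z - g z\<bar> \<le> B"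
  shows "mdist (cont_metric S) f g \<le> B"
  unfolding cont_metric_def
  by (rule mdist_cfunspace_le) (use assms in \<open>auto simp: dist_real_def\<close>)

text \<open>Stated for arbitrary solutions \<open>g1\<close>, \<open>g2\<close> rather than for
  values of \<open>fractal_operator\<close>, so that it is available before uniqueness:
  \<open>f1 = f2\<close> yields uniqueness, and general \<open>f1\<close>, \<open>f2\<close> yield
  continuity.\<close>

lemma alpha_fractal_mdist_le:
  fixes a b c d :: real
  defines "S \<equiv> {a..b} \<times> {c..d}"
  assumes ab: "a < b" and cd: "c < d"
    and x: "partition_seq a b x" and y: "partition_seq c d y"
    and q: "0 \<le> q" "\<And>i j z. i \<ge> 1 \<Longrightarrow> j \<ge> 1 \<Longrightarrow> z \<in> S \<Longrightarrow> \<bar>\<alpha> i j z\<bar> \<le> q"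
    and f1: "f1 \<in> mspace (cont_metric S)" and f2: "f2 \<in> mspace (cont_metric S)"
    and Lf1: "L f1 \<in> mspace (cont_metric S)" and Lf2: "L f2 \<in> mspace (cont_metric S)"
    and g1: "is_alpha_fractal a b c d x y \<alpha> L f1 g1"
    and g2: "is_alpha_fractal a b c d x y \<alpha> L f2 g2"
  shows "(1 - q) * mdist (cont_metric S) g1 g2
    \<le> mdist (cont_metric S) f1 f2 + q * mdist (cont_metric S) (L f1) (L f2)"
proof -
  let ?d = "mdist (cont_metric S)"
  \<comment> \<open>\<open>B\<close> contains the distance of \<open>g1\<close> and
    \<open>g2\<close> that is to be estimated; once this distance is shown to be at most
    \<open>B\<close>, its multiple by \<open>q\<close> moves to the left-hand side.\<close>
  define B where "B = ?d f1 f2 + q * (?d g1 g2 + ?d (L f1) (L f2))"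
  have B: "0 \<le> B"
    unfolding B_def using q(1) by (intro add_nonneg_nonneg mult_nonneg_nonneg) auto
  have g: "g1 \<in> mspace (cont_metric S)" "g2 \<in> mspace (cont_metric S)"
    using g1 g2 by (simp_all add: is_alpha_fractal_def S_def)
  have cell: "\<bar>g1 z - g2 z\<bar> \<le> B" if z: "z \<in> {a..<b} \<times> {c..<d}" for z
  proof -
    obtain s t where st: "z = (s, t)" "s \<in> {a..<b}" "t \<in> {c..<d}"
      using z by blast
    obtain i where i: "i \<ge> 1" "s \<in> {x (i - 1)..x i}"
      using ex_partition_cell[OF x st(2)] .
    obtain j where j: "j \<ge> 1" "t \<in> {y (j - 1)..y j}"
      using ex_partition_cell[OF y st(3)] .
    have zS: "z \<in> S"
      using st by (auto simp: S_def)
    \<comment> \<open>The rescaled point depends on the partition alone, so both functional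
      equations are evaluated at the same \<open>w\<close> with the same factor
      \<open>\<alpha> i j z\<close>.\<close>
    define w where "w = (part_inv a b x i s, part_inv c d y j t)"
    have wS: "w \<in> S"
      using part_inv_in[OF ab _ i] part_inv_in[OF cd _ j] x y
      by (simp add: w_def S_def partition_seq_def)
    have "g1 z = f1 z + \<alpha> i j z * (g1 w - L f1 w)" "g2 z = f2 z + \<alpha> i j z * (g2 w - L f2 w)"
      using g1 g2 i j st(1) by (simp_all add: is_alpha_fractal_def w_def)
    then have "g1 z - g2 z = (f1 z - f2 z) + \<alpha> i j z * ((g1 w - g2 w) - (L f1 w - L f2 w))"
      by (simp add: algebra_simps)
    also have "\<bar>\<dots>\<bar> \<le> \<bar>f1 z - f2 z\<bar> + \<bar>\<alpha> i j z\<bar> * \<bar>(g1 w - g2 w) - (L f1 w - L f2 w)\<bar>"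
      by (metis abs_mult abs_triangle_ineq)
    also have "\<dots> \<le> ?d f1 f2 + q * (?d g1 g2 + ?d (L f1) (L f2))"
      using abs_diff_le_mdist_cont_metric[OF f1 f2 zS] abs_diff_le_mdist_cont_metric[OF g wS]
        abs_diff_le_mdist_cont_metric[OF Lf1 Lf2 wS] q(2)[OF i(1) j(1) zS] q(1)
      by (intro add_mono mult_mono) auto
    finally show ?thesis
      by (simp add: B_def)
  qed
  \<comment> \<open>The edges \<open>s = b\<close> and \<open>t = d\<close> meet no cell; the bound
    reaches them by continuity of \<open>g1\<close> and \<open>g2\<close>.\<close>
  have cl: "closure ({a..<b} \<times> {c..<d}) = S"
    using ab cd by (simp add: closure_Times S_def)
  have "continuous_on S (\<lambda>z. \<bar>g1 z - g2 z\<bar>)"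
    using g by (intro continuous_intros continuous_on_mspace_cont_metric)
  then have "\<bar>g1 z - g2 z\<bar> \<le> B" if "z \<in> S" for z
    using continuous_le_on_closure[of "{a..<b} \<times> {c..<d}" "\<lambda>z. \<bar>g1 z - g2 z\<bar>" z B] cell that
    by (simp add: cl)
  then have "?d g1 g2 \<le> B"
    using B by (intro mdist_cont_metric_le)
  then show ?thesis
    by (simp add: B_def algebra_simps)
qed

theorem proposition4p24:
  fixes a b c d :: real
    and x y :: "nat \<Rightarrow> real"
    and \<alpha> :: "nat \<Rightarrow> nat \<Rightarrow> real \<times> real \<Rightarrow> real"
    and L :: "(real \<times> real \<Rightarrow> real) \<Rightarrow> (real \<times> real \<Rightarrow> real)"
  assumes "a < b" and "c < d"
    and "partition_seq a b x" and "partition_seq c d y"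
    and "scale_function ({a..b} \<times> {c..d}) \<alpha>"
    and "parameter_map a b c d L"
    and "permissible a b c d x y \<alpha> L"
    and "continuous_map (mtopology_of (lip_metric ({a..b} \<times> {c..d})))
           (mtopology_of (lip_metric ({a..b} \<times> {c..d}))) L"
  shows "continuous_map (mtopology_of (lip_metric ({a..b} \<times> {c..d})))
           (mtopology_of (cont_metric ({a..b} \<times> {c..d}))) (fractal_operator a b c d x y \<alpha> L)"
proof -
  let ?S = "{a..b} \<times> {c..d}"
  let ?C = "cont_metric ?S" and ?P = "lip_metric ?S"
  let ?F = "fractal_operator a b c d x y \<alpha> L"
  note C = Metric_space_mspace_mdist[of ?C] and P = Metric_space_mspace_mdist[of ?P]
  have ne: "?S \<noteq> {}"
    using assms(1,2) by simp
  obtain q where q: "0 \<le> q" "q < 1"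
      "\<And>i j z. i \<ge> 1 \<Longrightarrow> j \<ge> 1 \<Longrightarrow> z \<in> ?S \<Longrightarrow> \<bar>\<alpha> i j z\<bar> \<le> q"
    using scale_function_bound[OF assms(5) ne] by blast
  have L: "L f \<in> mspace ?P" if "f \<in> mspace ?P" for f
    using assms(6) that by (simp add: parameter_map_def)
  have bound: "(1 - q) * mdist ?C g1 g2 \<le> mdist ?C f1 f2 + q * mdist ?C (L f1) (L f2)"
    if "f1 \<in> mspace ?P" "f2 \<in> mspace ?P"
      "is_alpha_fractal a b c d x y \<alpha> L f1 g1" "is_alpha_fractal a b c d x y \<alpha> L f2 g2"
    for f1 f2 g1 g2
    using mspace_lip_metric_subset[of ?S] L that
    by (intro alpha_fractal_mdist_le[OF assms(1-4) q(1,3)]) auto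
  \<comment> \<open>The operator is a definite description, so its value solves the equation only
    after existence (permissibility) and uniqueness are known. For the latter, the right-hand side
    of \<open>bound\<close> vanishes when both functions are \<open>f\<close>, and
    \<open>1 - q > 0\<close>.\<close>
  have fractal: "is_alpha_fractal a b c d x y \<alpha> L f (?F f)" if f: "f \<in> mspace ?P" for f
  proof -
    obtain g where g: "is_alpha_fractal a b c d x y \<alpha> L f g"
      using assms(7) f by (auto simp: permissible_def)
    have "h = g" if h: "is_alpha_fractal a b c d x y \<alpha> L f h" for h
    proof -
      have mem: "h \<in> mspace ?C" "g \<in> mspace ?C" "f \<in> mspace ?C" "L f \<in> mspace ?C"
        using g h f L[OF f] mspace_lip_metric_subset[of ?S] by (auto simp: is_alpha_fractal_def)
      have "(1 - q) * mdist ?C h g \<le> 0"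
        using bound[OF f f h g] Metric_space.mdist_zero[OF C mem(3)] Metric_space.mdist_zero[OF C mem(4)] by simp
      then have "mdist ?C h g \<le> 0"
        using q(2) by (simp add: mult_le_0_iff)
      then show "h = g"
        using mem Metric_space.zero[OF C mem(1,2)] Metric_space.nonneg[OF C, of h g] by simp
    qed
    with g have "\<exists>!g. is_alpha_fractal a b c d x y \<alpha> L f g"
      by blast
    then show ?thesis
      unfolding fractal_operator_def by (rule theI')
  qed
  have "\<exists>\<delta>>0. \<forall>h. h \<in> mspace ?P \<and> mdist ?P f h < \<delta> \<longrightarrow> mdist ?C (?F f) (?F h) < \<epsilon>"
    if f: "f \<in> mspace ?P" and \<epsilon>: "0 < \<epsilon>" for f \<epsilon>
  proof -
    \<comment> \<open>Half of the error goes to the distance of \<open>f\<close> and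
      \<open>h\<close>, half to that of \<open>L f\<close> and \<open>L h\<close>; the factor
      \<open>1 - q\<close> cancels against the one in \<open>bound\<close>.\<close>
    define \<eta> where "\<eta> = (1 - q) * \<epsilon> / 2"
    have \<eta>: "0 < \<eta>"
      using q(2) \<epsilon> by (simp add: \<eta>_def)
    obtain \<delta> where \<delta>: "0 < \<delta>"
        "\<And>h. h \<in> mspace ?P \<Longrightarrow> mdist ?P f h < \<delta> \<Longrightarrow> mdist ?P (L f) (L h) < \<eta>"
      using assms(8) f \<eta> unfolding mtopology_of_def
      unfolding Metric_space.metric_continuous_map[OF P P] by meson
    \<comment> \<open>In the minimum, \<open>\<eta>\<close> bounds the distance of \<open>f\<close>
      and \<open>h\<close> directly, while \<open>\<delta>\<close> bounds that of \<open>L f\<close>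
      and \<open>L h\<close> through continuity of \<open>L\<close>.\<close>
    have "mdist ?C (?F f) (?F h) < \<epsilon>"
      if h: "h \<in> mspace ?P" and less: "mdist ?P f h < min \<delta> \<eta>" for h
    proof -
      have "q * mdist ?C (L f) (L h) \<le> 1 * mdist ?C (L f) (L h)"
        using q by (intro mult_right_mono) auto
      then have "(1 - q) * mdist ?C (?F f) (?F h) \<le> mdist ?C f h + mdist ?C (L f) (L h)"
        using bound[OF f h fractal[OF f] fractal[OF h]] by linarith
      also have "\<dots> < \<eta> + \<eta>"
        using less \<delta>(2)[OF h] by (intro add_strict_mono) (auto simp: mdist_lip_metric)
      also have "\<dots> = (1 - q) * \<epsilon>"
        by (simp add: \<eta>_def)
      finally show ?thesis
        using q(2) by simp
    qed
    then show ?thesis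
      using \<delta>(1) \<eta> by (intro exI[of _ "min \<delta> \<eta>"]) auto
  qed
  moreover have "?F f \<in> mspace ?C" if "f \<in> mspace ?P" for f
    using fractal[OF that] by (simp add: is_alpha_fractal_def)
  ultimately show ?thesis
    unfolding mtopology_of_def Metric_space.metric_continuous_map[OF P C] by blast
qed

end
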